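(* Let $(M,d_M,\nu_M)$ and $(N,d_N,\mu_N)$ be measured metric spaces, with $\mu_N$ $\sigma$-finite, and let $f:M\to N$ be a map. Then $f$ is R.-N.-lipschitz if and only if it is a v.b.-map.
   Context: A measured metric space is a metric space with a measure on its Borel $\sigma$-algebra. If $f:M\to N$ is measurable and $f_\star\nu_M$ (defined by $f_\star\nu_M(A)=\nu_M(f^{-1}(A))$) is absolutely continuous with respect to the $\sigma$-finite measure $\mu_N$, the Fiber Volume of $f$ is the Radon–Nikodym derivative $\mathrm{Vol}_f=\partial(f_\star\nu_M)/\partial\mu_N$. The map $f$ is R.-N.-lipschitz (Radon–Nikodym-lipschitz) if it is lipschitz and has (well-defined and) bounded Fiber Volume, bounds being understood up to $\mu_N$-null sets. The map $f$ is a v.b.-map (volume bounded map) if it is measurable, lipschitz and there is a constant $C$ such that $\nu_M(f^{-1}(A))\le C\,\mu_N(A)$ for all measurable $A\subseteq N$. *)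

theory Defs
  imports "HOL-Analysis.Analysis"
begin

text \<open>
  Metric spaces are elements of the library type \<^typ>\<open>'a metric\<close>, so that the carrier is an
  arbitrary (possibly empty) set. The library's \<^term>\<open>borel\<close> exists only for type-class topologies, hence
  the explicit Borel sigma-algebra.
\<close>

definition measured_metric_space :: "'a metric \<Rightarrow> 'a measure \<Rightarrow> bool" where
  "measured_metric_space m \<nu> \<longleftrightarrow>
     space \<nu> = mspace m \<and> sets \<nu> = sigma_sets (mspace m) {U. openin (mtopology_of m) U}"

lemma measured_metric_space_euclidean:
  "measured_metric_space euclidean_metric \<nu> \<longleftrightarrow> sets \<nu> = sets borel"
  using sets_eq_imp_space_eq[of \<nu> borel] by (auto simp: measured_metric_space_def borel_def)

text \<open>
  The push-forward is \<^const>\<open>distr\<close>, which is the push-forward measure only for measurable maps;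
  measurability is therefore part of well-definedness of the Fiber Volume.
\<close>

definition fiber_volume_defined :: "'a measure \<Rightarrow> 'b measure \<Rightarrow> ('a \<Rightarrow> 'b) \<Rightarrow> bool" where
  "fiber_volume_defined \<nu> \<mu> f \<longleftrightarrow>
     f \<in> measurable \<nu> \<mu> \<and> sigma_finite_measure \<mu> \<and> absolutely_continuous \<mu> (distr \<nu> \<mu> f)"

definition fiber_volume :: "'a measure \<Rightarrow> 'b measure \<Rightarrow> ('a \<Rightarrow> 'b) \<Rightarrow> 'b \<Rightarrow> ennreal" where
  "fiber_volume \<nu> \<mu> f = RN_deriv \<mu> (distr \<nu> \<mu> f)"

definition RN_lipschitz ::
    "'a metric \<Rightarrow> 'a measure \<Rightarrow> 'b metric \<Rightarrow> 'b measure \<Rightarrow> ('a \<Rightarrow> 'b) \<Rightarrow> bool" where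
  "RN_lipschitz mM \<nu> mN \<mu> f \<longleftrightarrow>
     Lipschitz_continuous_map mM mN f \<and>
     fiber_volume_defined \<nu> \<mu> f \<and>
     (\<exists>C::real. C \<ge> 0 \<and> (AE y in \<mu>. fiber_volume \<nu> \<mu> f y \<le> ennreal C))"

text \<open>
  In \<^typ>\<open>ennreal\<close> the product \<open>0 * \<infinity>\<close> is \<open>0\<close>, the usual measure-theoretic convention.
\<close>

definition vb_map ::
    "'a metric \<Rightarrow> 'a measure \<Rightarrow> 'b metric \<Rightarrow> 'b measure \<Rightarrow> ('a \<Rightarrow> 'b) \<Rightarrow> bool" where
  "vb_map mM \<nu> mN \<mu> f \<longleftrightarrow>
     f \<in> measurable \<nu> \<mu> \<and>
     Lipschitz_continuous_map mM mN f \<and>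
     (\<exists>C::real. C \<ge> 0 \<and>
        (\<forall>A\<in>sets \<mu>. emeasure \<nu> (f -` A \<inter> space \<nu>) \<le> ennreal C * emeasure \<mu> A))"

end

theory Submission
  imports Defs
begin

text \<open>Both notions contain measurability and the Lipschitz condition, so only the two volume
  bounds need comparing. If the Fiber Volume exists, it is a density of the push-forward with
  respect to \<open>\<mu>\<close>, and for finite c a density is a.e. at most c exactly when the
  measure it defines is at most c times the base measure
  (\<open>AE_le_const_iff_emeasure_density_le\<close>). One direction is integration; the other
  holds because the set where the density exceeds c must be null, as seen on pieces of finite
  measure. Existence is no obstacle: the v.b. inequality forces absolute continuity
  (\<open>absolutely_continuousI_emeasure_le\<close>).\<close>

lemma (in sigma_finite_measure) AE_le_const_iff_emeasure_density_le:
  fixes g :: "'a \<Rightarrow> ennreal"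
  assumes g [measurable]: "g \<in> borel_measurable M" and c: "c < \<infinity>"
  shows "(AE x in M. g x \<le> c) \<longleftrightarrow> (\<forall>A\<in>sets M. emeasure (density M g) A \<le> c * emeasure M A)"
proof
  assume bound: "AE x in M. g x \<le> c"
  show "\<forall>A\<in>sets M. emeasure (density M g) A \<le> c * emeasure M A"
  proof
    fix A assume A [measurable]: "A \<in> sets M"
    have "emeasure (density M g) A = (\<integral>\<^sup>+x. g x * indicator A x \<partial>M)"
      by (simp add: emeasure_density)
    also have "\<dots> \<le> (\<integral>\<^sup>+x. c * indicator A x \<partial>M)"
      using bound by (intro nn_integral_mono_AE) (auto elim!: eventually_mono intro: mult_right_mono)
    also have "\<dots> = c * emeasure M A"
      by (simp add: nn_integral_cmult_indicator)
    finally show "emeasure (density M g) A \<le> c * emeasure M A" .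
  qed
next
  assume bound: "\<forall>A\<in>sets M. emeasure (density M g) A \<le> c * emeasure M A"
  \<comment> \<open>The exhaustion by sets of finite measure keeps the integrals finite, so that
    they can be subtracted.\<close>
  obtain F :: "nat \<Rightarrow> 'a set" where F: "range F \<subseteq> sets M" "(\<Union>i. F i) = space M"
    "\<And>i. emeasure M (F i) \<noteq> \<infinity>"
    using sigma_finite by metis
  have "AE x in M. x \<in> F i \<longrightarrow> g x \<le> c" for i
  proof -
    have [measurable]: "F i \<in> sets M" using F(1) by auto
    \<comment> \<open>On \<open>B\<close> the function g exceeds c pointwise, yet by
      \<open>bound\<close> its integral is at most that of c. So the nonnegative function g - c has
      integral 0 over \<open>B\<close> and vanishes there a.e., making \<open>B\<close>
      null.\<close>
    define B where "B = {x \<in> space M. c < g x} \<inter> F i"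
    have B [measurable]: "B \<in> sets M" unfolding B_def by measurable
    have "emeasure M B \<le> emeasure M (F i)"
      by (intro emeasure_mono) (auto simp: B_def)
    then have fin: "c * emeasure M B \<noteq> \<infinity>"
      using F(3)[of i] c by (auto simp: ennreal_mult_eq_top_iff top_unique)
    have "(\<integral>\<^sup>+x. (g x * indicator B x - c * indicator B x) \<partial>M)
        = (\<integral>\<^sup>+x. g x * indicator B x \<partial>M) - (\<integral>\<^sup>+x. c * indicator B x \<partial>M)"
    proof (rule nn_integral_diff)
      show "(\<integral>\<^sup>+x. c * indicator B x \<partial>M) \<noteq> \<infinity>"
        using fin by (simp add: nn_integral_cmult_indicator)
    qed (auto simp: B_def indicator_def)
    also have "\<dots> = 0"
    proof -
      have "emeasure (density M g) B \<le> c * emeasure M B"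
        using bound B by blast
      \<comment> \<open>Finiteness matters here: in \<open>ennreal\<close>, top - top is top, so the
        inequality alone would not make the difference 0.\<close>
      moreover from this fin have "emeasure (density M g) B < top"
        by (auto simp: less_top[symmetric] top_unique)
      ultimately show ?thesis
        by (simp add: emeasure_density nn_integral_cmult_indicator diff_eq_0_ennreal)
    qed
    finally have "AE x in M. g x * indicator B x - c * indicator B x = 0"
      by (subst (asm) nn_integral_0_iff_AE) auto
    with AE_space show ?thesis
    proof eventually_elim
      case (elim x)
      show ?case
      proof (rule ccontr)
        assume "\<not> (x \<in> F i \<longrightarrow> g x \<le> c)"
        then have "x \<in> B" and "c < g x"
          using elim(1) by (auto simp: B_def)
        then show False
          using elim(2) by (auto simp: diff_eq_0_iff_ennreal)
      qed
    qed
  qed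
  then have "AE x in M. \<forall>i. x \<in> F i \<longrightarrow> g x \<le> c"
    unfolding AE_all_countable by blast
  then show "AE x in M. g x \<le> c"
    using AE_space by eventually_elim (use F(2) in blast)
qed

text \<open>A null set of \<open>M\<close> gets measure at most c * 0 = 0, even for infinite
  c.\<close>

lemma absolutely_continuousI_emeasure_le:
  assumes "sets N = sets M" and "\<And>A. A \<in> sets M \<Longrightarrow> emeasure N A \<le> c * emeasure M A"
  shows "absolutely_continuous M N"
  unfolding absolutely_continuous_def
proof
  fix A assume "A \<in> null_sets M"
  then show "A \<in> null_sets N"
    using assms(1) assms(2)[of A] by (auto simp: null_sets_def)
qed

lemma fiber_volume_bounded_iff:
  assumes "fiber_volume_defined \<nu> \<mu> f" and c: "c < \<infinity>"
  shows "(AE y in \<mu>. fiber_volume \<nu> \<mu> f y \<le> c) \<longleftrightarrow>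
    (\<forall>A\<in>sets \<mu>. emeasure \<nu> (f -` A \<inter> space \<nu>) \<le> c * emeasure \<mu> A)"
proof -
  interpret sigma_finite_measure \<mu>
    using assms(1) by (simp add: fiber_volume_defined_def)
  \<comment> \<open>Radon-Nikodym: this identity turns the density criterion into one about
    preimages under f.\<close>
  have "density \<mu> (fiber_volume \<nu> \<mu> f) = distr \<nu> \<mu> f"
    using assms(1) unfolding fiber_volume_defined_def fiber_volume_def
    by (intro density_RN_deriv) auto
  moreover have "f \<in> measurable \<nu> \<mu>"
    using assms(1) by (simp add: fiber_volume_defined_def)
  moreover have "fiber_volume \<nu> \<mu> f \<in> borel_measurable \<mu>"
    by (simp add: fiber_volume_def)
  ultimately show ?thesis
    by (simp add: AE_le_const_iff_emeasure_density_le[OF _ c] emeasure_distr)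
qed

theorem proposition1p3p5:
  fixes mM :: "'a metric" and \<nu> :: "'a measure"
    and mN :: "'b metric" and \<mu> :: "'b measure"
    and f :: "'a \<Rightarrow> 'b"
  assumes "measured_metric_space mM \<nu>"
    and "measured_metric_space mN \<mu>"
    and "sigma_finite_measure \<mu>"
    and "f \<in> mspace mM \<rightarrow> mspace mN"
  shows "RN_lipschitz mM \<nu> mN \<mu> f \<longleftrightarrow> vb_map mM \<nu> mN \<mu> f"
proof -
  have "fiber_volume_defined \<nu> \<mu> f"
    if f: "f \<in> measurable \<nu> \<mu>"
      and "\<forall>A\<in>sets \<mu>. emeasure \<nu> (f -` A \<inter> space \<nu>) \<le> ennreal C * emeasure \<mu> A" for C
    using that assms(3) unfolding fiber_volume_defined_def
    by (auto intro!: absolutely_continuousI_emeasure_le[where c = "ennreal C"]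
        simp: emeasure_distr)
  moreover have "f \<in> measurable \<nu> \<mu>" if "fiber_volume_defined \<nu> \<mu> f"
    using that by (simp add: fiber_volume_defined_def)
  ultimately show ?thesis
    \<comment> \<open>The same constant C serves in both directions.\<close>
    unfolding RN_lipschitz_def vb_map_def
    using fiber_volume_bounded_iff[of \<nu> \<mu> f, OF _ ennreal_less_top[folded infinity_ennreal_def]]
    by metis
qed

end
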